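(* Let $X$ be a simplicial complex whose geometric realization $\Omega=|X|\subset\mathbb R^n$ is star-shaped with respect to a point $a\in\Omega$. Let $\mathrm{Co}_k^S$ be the linear operator on $C_k(X)$ defined by $$\mathrm{Co}_k^S(\sigma)=L[a,v_0,\dots,v_k]\qquad\text{for } \sigma=[v_0,\dots,v_k]\in X^k .$$ Then $\mathrm{Co}^S$ is a singular cone operator with contraction point $a$; that is, $\mathrm{Co}_k^S$ maps $C_k(X)$ into $S_{k+1}^{\mathrm{Lip}}(\Omega)$, $\mathrm{Co}^S_{k-1}(\partial_k\sigma)+\partial^S_{k+1}\mathrm{Co}^S_k(\sigma)=L\sigma$ for all $\sigma\in X^k$, $k\ge1$, and $\partial_1^S\mathrm{Co}_0^S(v)=L[v]-L[a]$ for all $v\in X^0$.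
   Context: $\Omega$ is star-shaped with respect to $a\in\Omega$ if for every $x\in\Omega$ the segment from $x$ to $a$ lies in $\Omega$. Fix a total order on the vertices of $X$; each $\sigma\in X^k$ is written $[v_0,\dots,v_k]$ with $v_0<\dots<v_k$. $C_k(X)$ is the real vector space with basis $X^k$, with boundary $\partial_k[v_0,\dots,v_k]=\sum_i(-1)^i[v_0,\dots,\widehat{v_i},\dots,v_k]$. $Q_k$ is the standard simplex with vertices $q_0=0$, $q_i=e_i$ ($1\le i\le k$). A Lipschitz singular $k$-simplex of $M$ is a Lipschitz map $T:Q_k\to M$; $S_k^{\mathrm{Lip}}(M)$ is the real vector space of finite formal linear combinations of these. For points $a_0,\dots,a_k\in\mathbb R^n$ (not necessarily affinely independent), $L[a_0,\dots,a_k]:Q_k\to\mathbb R^n$ is $L[a_0,\dots,a_k](x)=a_0+\sum_{i=1}^k x_i(a_i-a_0)$; for $\sigma=[v_0,\dots,v_k]$, $L\sigma=L[v_0,\dots,v_k]$. The boundary is $\partial_k^S T=\sum_{i=0}^k(-1)^i\,T\circ L[q_0,\dots,\widehat{q_i},\dots,q_k]$. *)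

theory Defs
  imports "HOL-Analysis.Analysis" "HOL-Analysis.Finite_Function_Topology"
begin

(* Star-shapedness with a prescribed centre; the library's starlike leaves the centre existential. *)
definition star_shaped_wrt :: "'a::real_vector set \<Rightarrow> 'a \<Rightarrow> bool" where
  "star_shaped_wrt M a \<longleftrightarrow> a \<in> M \<and> (\<forall>x\<in>M. closed_segment x a \<subseteq> M)"


(* The library's simplicial_complex without finiteness. As there, a simplex is the closed convex
   set and the empty set counts as a (-1)-simplex. *)
definition geometric_complex :: "'a::euclidean_space set set \<Rightarrow> bool" where
  "geometric_complex X \<longleftrightarrow>
     (\<forall>S\<in>X. \<exists>n. n simplex S) \<and>
     (\<forall>F S. S \<in> X \<and> F face_of S \<longrightarrow> F \<in> X) \<and>
     (\<forall>S S'. S \<in> X \<and> S' \<in> X \<longrightarrow> (S \<inter> S') face_of S)"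

lemma simplicial_complex_iff_finite_geometric_complex:
  "simplicial_complex X \<longleftrightarrow> finite X \<and> geometric_complex X"
  unfolding simplicial_complex_def geometric_complex_def by simp

definition vertices :: "'a::euclidean_space set set \<Rightarrow> 'a set" where
  "vertices X = {v. \<exists>S\<in>X. v extreme_point_of S}"

(* X^k: each k-simplex is represented by its list of vertices, strictly increasing for r. *)
definition ordered_simplices ::
    "'a::euclidean_space set set \<Rightarrow> 'a rel \<Rightarrow> nat \<Rightarrow> 'a list set" where
  "ordered_simplices X r k =
     {vs. sorted_wrt (\<lambda>u v. (u, v) \<in> r \<and> u \<noteq> v) vs \<and>
          (\<exists>S\<in>X. int k simplex S \<and> set vs = {v. v extreme_point_of S})}"


(* The free real vector space on a set B consists of the c :: 'b \<Rightarrow>\<^sub>0 real with keys c \<subseteq> B;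
   the basis vector of b is Poly_Mapping.single b 1. *)
abbreviation basis :: "'b \<Rightarrow> 'b \<Rightarrow>\<^sub>0 real" where
  "basis b \<equiv> Poly_Mapping.single b 1"

definition linear_extension ::
    "('b \<Rightarrow> 'c::real_vector) \<Rightarrow> ('b \<Rightarrow>\<^sub>0 real) \<Rightarrow> 'c" where
  "linear_extension f c = (\<Sum>b\<in>Poly_Mapping.keys c. Poly_Mapping.lookup c b *\<^sub>R f b)"

definition linear_on_subspace ::
    "'b::real_vector set \<Rightarrow> ('b \<Rightarrow> 'c::real_vector) \<Rightarrow> bool" where
  "linear_on_subspace V f \<longleftrightarrow>
     (\<forall>x\<in>V. \<forall>y\<in>V. f (x + y) = f x + f y) \<and> (\<forall>t. \<forall>x\<in>V. f (t *\<^sub>R x) = t *\<^sub>R f x)"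

definition omit :: "nat \<Rightarrow> 'b list \<Rightarrow> 'b list" where
  "omit i xs = take i xs @ drop (Suc i) xs"


definition simplicial_chains ::
    "'a::euclidean_space set set \<Rightarrow> 'a rel \<Rightarrow> nat \<Rightarrow> ('a list \<Rightarrow>\<^sub>0 real) set" where
  "simplicial_chains X r k = {c. Poly_Mapping.keys c \<subseteq> ordered_simplices X r k}"

definition simplicial_boundary :: "nat \<Rightarrow> ('a list \<Rightarrow>\<^sub>0 real) \<Rightarrow> ('a list \<Rightarrow>\<^sub>0 real)" where
  "simplicial_boundary k = linear_extension
     (\<lambda>vs. if k = 0 then 0 else \<Sum>i\<le>k. (-1) ^ i *\<^sub>R basis (omit i vs))"


(* The spaces R^k, for all k at once, are the subspaces of nat \<Rightarrow>\<^sub>0 real of vectors supported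
   in {1..k}, so that R^k is contained in R^(k+1). *)
definition std_vertex :: "nat \<Rightarrow> (nat \<Rightarrow>\<^sub>0 real)" where
  "std_vertex i = (if i = 0 then 0 else basis i)"

definition std_simplex :: "nat \<Rightarrow> (nat \<Rightarrow>\<^sub>0 real) set" where
  "std_simplex k = convex hull (std_vertex ` {0..k})"

(* L[a_0,...,a_k] for the list as = [a_0,...,a_k]. Maps on std_simplex k are made extensional, so
   that equal maps on std_simplex k are equal as functions. *)
definition affine_simplex ::
    "'v::real_vector list \<Rightarrow> (nat \<Rightarrow>\<^sub>0 real) \<Rightarrow> 'v" where
  "affine_simplex as =
     (\<lambda>x\<in>std_simplex (length as - 1).
        as ! 0 + (\<Sum>i=1..length as - 1. Poly_Mapping.lookup x i *\<^sub>R (as ! i - as ! 0)))"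

(* The library's metric on nat \<Rightarrow>\<^sub>0 real is the l1-metric; on R^k it is Lipschitz equivalent
   to the Euclidean one, see lipschitz_std_simplex_iff_euclidean below. *)
definition lipschitz_simplices ::
    "nat \<Rightarrow> 'a::metric_space set \<Rightarrow> ((nat \<Rightarrow>\<^sub>0 real) \<Rightarrow> 'a) set" where
  "lipschitz_simplices k M =
     {T \<in> std_simplex k \<rightarrow>\<^sub>E M. \<exists>C. C-lipschitz_on (std_simplex k) T}"

definition lipschitz_chains ::
    "nat \<Rightarrow> 'a::metric_space set \<Rightarrow> (((nat \<Rightarrow>\<^sub>0 real) \<Rightarrow> 'a) \<Rightarrow>\<^sub>0 real) set" where
  "lipschitz_chains k M = {c. Poly_Mapping.keys c \<subseteq> lipschitz_simplices k M}"

definition singular_boundary ::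
    "nat \<Rightarrow> (((nat \<Rightarrow>\<^sub>0 real) \<Rightarrow> 'a) \<Rightarrow>\<^sub>0 real) \<Rightarrow> (((nat \<Rightarrow>\<^sub>0 real) \<Rightarrow> 'a) \<Rightarrow>\<^sub>0 real)" where
  "singular_boundary k = linear_extension
     (\<lambda>T. if k = 0 then 0 else
        \<Sum>i\<le>k. (-1) ^ i *\<^sub>R
          basis (compose (std_simplex (k - 1)) T
                   (affine_simplex (omit i (map std_vertex [0..<Suc k])))))"


definition singular_cone_operator ::
    "'a::euclidean_space set set \<Rightarrow> 'a rel \<Rightarrow> 'a \<Rightarrow>
     (nat \<Rightarrow> ('a list \<Rightarrow>\<^sub>0 real) \<Rightarrow> (((nat \<Rightarrow>\<^sub>0 real) \<Rightarrow> 'a) \<Rightarrow>\<^sub>0 real)) \<Rightarrow> bool" where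
  "singular_cone_operator X r a Co \<longleftrightarrow>
     (\<forall>k. linear_on_subspace (simplicial_chains X r k) (Co k) \<and>
          Co k \<in> simplicial_chains X r k \<rightarrow> lipschitz_chains (Suc k) (\<Union>X)) \<and>
     (\<forall>k\<ge>1. \<forall>\<sigma>\<in>ordered_simplices X r k.
        Co (k - 1) (simplicial_boundary k (basis \<sigma>)) + singular_boundary (k + 1) (Co k (basis \<sigma>))
          = basis (affine_simplex \<sigma>)) \<and>
     (\<forall>v. [v] \<in> ordered_simplices X r 0 \<longrightarrow>
        singular_boundary 1 (Co 0 (basis [v])) = basis (affine_simplex [v]) - basis (affine_simplex [a]))"

(* Co^S. The degree k is determined by the length of the vertex lists, so one linear map on
   chains of lists serves for all k. *)
definition cone_S :: "'a::real_vector \<Rightarrow> ('a list \<Rightarrow>\<^sub>0 real) \<Rightarrow> (((nat \<Rightarrow>\<^sub>0 real) \<Rightarrow> 'a) \<Rightarrow>\<^sub>0 real)" where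
  "cone_S a = linear_extension (\<lambda>vs. basis (affine_simplex (a # vs)))"


lemma keys_std_simplex:
  assumes "x \<in> std_simplex k"
  shows "Poly_Mapping.keys x \<subseteq> {1..k}"
proof -
  let ?V = "{y :: nat \<Rightarrow>\<^sub>0 real. \<forall>i. i \<notin> {1..k} \<longrightarrow> Poly_Mapping.lookup y i = 0}"
  have sc: "Poly_Mapping.lookup (t *\<^sub>R y) i = t * Poly_Mapping.lookup y i"
    for t i and y :: "nat \<Rightarrow>\<^sub>0 real"
    by (simp add: scaleR_poly_mapping_def)
  have "convex ?V"
    by (auto simp: convex_def lookup_add sc)
  moreover have "std_vertex ` {0..k} \<subseteq> ?V"
    by (auto simp: std_vertex_def lookup_single)
  ultimately have "std_simplex k \<subseteq> ?V"
    unfolding std_simplex_def by (rule hull_minimal[rotated])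
  with assms have "x \<in> ?V" by blast
  then show ?thesis by (force simp: in_keys_iff)
qed

lemma lipschitz_std_simplex_iff_euclidean:
  fixes T :: "(nat \<Rightarrow>\<^sub>0 real) \<Rightarrow> 'a::metric_space"
  shows "(\<exists>C. C-lipschitz_on (std_simplex k) T) \<longleftrightarrow>
    (\<exists>C. \<forall>x\<in>std_simplex k. \<forall>y\<in>std_simplex k. dist (T x) (T y) \<le>
       C * L2_set (\<lambda>i. Poly_Mapping.lookup x i - Poly_Mapping.lookup y i) {1..k})"
    (is "?l \<longleftrightarrow> (\<exists>C. \<forall>x\<in>_. \<forall>y\<in>_. _ \<le> C * ?e x y)")
proof -
  have d: "dist x y = (\<Sum>i\<in>{1..k}. \<bar>Poly_Mapping.lookup x i - Poly_Mapping.lookup y i\<bar>)"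
    if "x \<in> std_simplex k" "y \<in> std_simplex k" for x y
    unfolding dist_poly_mapping_def dist_real_def
    using keys_std_simplex[OF that(1)] keys_std_simplex[OF that(2)]
    by (intro sum.mono_neutral_left) (auto simp: in_keys_iff)
  have le1: "?e x y \<le> dist x y" if "x \<in> std_simplex k" "y \<in> std_simplex k" for x y
    unfolding d[OF that] by (rule L2_set_le_sum_abs)
  have le2: "dist x y \<le> sqrt k * ?e x y" if "x \<in> std_simplex k" "y \<in> std_simplex k" for x y
    unfolding d[OF that]
    using L2_set_mult_ineq[of "\<lambda>_. 1" "\<lambda>i. Poly_Mapping.lookup x i - Poly_Mapping.lookup y i" "{1..k}"]
    by (simp add: L2_set_def)
  show ?thesis
  proof
    assume ?l
    then obtain C where "C-lipschitz_on (std_simplex k) T" by blast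
    then have "C \<ge> 0" and C: "\<And>x y. x \<in> std_simplex k \<Longrightarrow> y \<in> std_simplex k \<Longrightarrow>
        dist (T x) (T y) \<le> C * dist x y"
      by (auto simp: lipschitz_on_def)
    have "dist (T x) (T y) \<le> (C * sqrt k) * ?e x y"
      if "x \<in> std_simplex k" "y \<in> std_simplex k" for x y
      using C[OF that] mult_left_mono[OF le2[OF that] \<open>C \<ge> 0\<close>] by (simp add: mult.assoc)
    then show "\<exists>C. \<forall>x\<in>std_simplex k. \<forall>y\<in>std_simplex k. dist (T x) (T y) \<le> C * ?e x y"
      by blast
  next
    assume "\<exists>C. \<forall>x\<in>std_simplex k. \<forall>y\<in>std_simplex k. dist (T x) (T y) \<le> C * ?e x y"
    then obtain C where C: "\<And>x y. x \<in> std_simplex k \<Longrightarrow> y \<in> std_simplex k \<Longrightarrow>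
        dist (T x) (T y) \<le> C * ?e x y" by blast
    have "dist (T x) (T y) \<le> \<bar>C\<bar> * dist x y"
      if "x \<in> std_simplex k" "y \<in> std_simplex k" for x y
    proof -
      have "C * ?e x y \<le> \<bar>C\<bar> * ?e x y" by (intro mult_right_mono) auto
      also have "\<dots> \<le> \<bar>C\<bar> * dist x y" by (intro mult_left_mono le1 that) auto
      finally show ?thesis using C[OF that] by linarith
    qed
    then have "\<bar>C\<bar>-lipschitz_on (std_simplex k) T" by (intro lipschitz_onI) auto
    then show ?l by blast
  qed
qed

end

(* L[a_0,...,a_k] and the face maps of Q_k are restrictions of affine maps, so L[a_0,...,a_k]
   composed with the i-th face map is L applied to the list with a_i omitted. Hence the
   boundary of L[a,v_0,...,v_k] is L[v_0,...,v_k] (the face opposite a) minus the cone of the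
   boundary. The image of L[a,v_0,...,v_k] lies in the convex hull of a and the simplex, which is
   the union of the segments from a to points of the simplex and so lies in the star-shaped set. *)

theory Submission
  imports Defs
begin

text \<open>Two chains and their sum have different supports, since coefficients may cancel. Summing
  over one common finite set lets linearity be checked term by term.\<close>

lemma linear_extension_superset:
  assumes "finite A" "Poly_Mapping.keys c \<subseteq> A"
  shows "linear_extension f c = (\<Sum>b\<in>A. Poly_Mapping.lookup c b *\<^sub>R f b)"
  unfolding linear_extension_def using assms
  by (intro sum.mono_neutral_left) (auto simp: in_keys_iff)

lemma lookup_scaleR_poly_mapping:
  fixes c :: "'b \<Rightarrow>\<^sub>0 real"
  shows "Poly_Mapping.lookup (t *\<^sub>R c) b = t * Poly_Mapping.lookup c b"
  by (simp add: scaleR_poly_mapping_def)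

lemma linear_linear_extension:
  fixes f :: "'b \<Rightarrow> 'c::real_vector"
  shows "linear (linear_extension f)"
proof
  fix x y :: "'b \<Rightarrow>\<^sub>0 real" and t :: real
  let ?A = "Poly_Mapping.keys x \<union> Poly_Mapping.keys y"
  have *: "linear_extension f c = (\<Sum>b\<in>?A. Poly_Mapping.lookup c b *\<^sub>R f b)"
    if "Poly_Mapping.keys c \<subseteq> ?A" for c
    using that by (intro linear_extension_superset) auto
  have "Poly_Mapping.keys (x + y) \<subseteq> ?A" "Poly_Mapping.keys (t *\<^sub>R x) \<subseteq> ?A"
    by (auto simp: in_keys_iff lookup_add lookup_scaleR_poly_mapping)
  then show "linear_extension f (x + y) = linear_extension f x + linear_extension f y"
    and "linear_extension f (t *\<^sub>R x) = t *\<^sub>R linear_extension f x"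
    by (simp_all add: * lookup_add lookup_scaleR_poly_mapping scaleR_add_left sum.distrib
        scaleR_sum_right)
qed

lemma linear_extension_basis [simp]: "linear_extension f (basis b) = f b"
  by (simp add: linear_extension_def)

text \<open>Only an inclusion holds in general: \<open>g\<close> may identify basis elements, and
  then coefficients can cancel. The inclusion keeps the cone of a chain in the span of Lipschitz
  simplices.\<close>

lemma keys_linear_extension_basis:
  "Poly_Mapping.keys (linear_extension (\<lambda>b. basis (g b)) c) \<subseteq> g ` Poly_Mapping.keys c"
proof -
  have "Poly_Mapping.keys (linear_extension (\<lambda>b. basis (g b)) c)
      \<subseteq> (\<Union>b\<in>Poly_Mapping.keys c. Poly_Mapping.keys (Poly_Mapping.lookup c b *\<^sub>R basis (g b)))"
    unfolding linear_extension_def by (rule keys_sum)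
  also have "\<dots> \<subseteq> g ` Poly_Mapping.keys c"
    by (auto simp: in_keys_iff lookup_scaleR_poly_mapping lookup_single when_def split: if_splits)
  finally show ?thesis .
qed

lemma omit_map: "omit i (map f xs) = map f (omit i xs)"
  by (simp add: omit_def take_map drop_map)

lemma length_omit [simp]: "i < length xs \<Longrightarrow> length (omit i xs) = length xs - 1"
  by (auto simp: omit_def)

lemma set_omit_subset: "set (omit i xs) \<subseteq> set xs"
  by (auto simp: omit_def dest: in_set_takeD in_set_dropD)

lemma omit_0_Cons [simp]: "omit 0 (x # xs) = xs"
  and omit_Suc_Cons [simp]: "omit (Suc i) (x # xs) = x # omit i xs"
  by (simp_all add: omit_def)

text \<open>The map behind \<open>affine_simplex\<close> before restriction. On the whole space it
  is affine, so it can be composed and expanded without domain conditions.\<close>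

definition affine_formula :: "'v::real_vector list \<Rightarrow> (nat \<Rightarrow>\<^sub>0 real) \<Rightarrow> 'v" where
  "affine_formula as x =
     as ! 0 + (\<Sum>i=1..length as - 1. Poly_Mapping.lookup x i *\<^sub>R (as ! i - as ! 0))"

lemma affine_simplex_eq_restrict:
  "affine_simplex as = restrict (affine_formula as) (std_simplex (length as - 1))"
  by (auto simp: affine_simplex_def affine_formula_def)

text \<open>The value at the origin is \<open>as ! 0\<close>; removing it leaves the linear
  part.\<close>

lemma linear_affine_formula: "linear (\<lambda>x. affine_formula as x - as ! 0)"
  by (rule linearI)
    (simp_all add: affine_formula_def lookup_add lookup_scaleR_poly_mapping scaleR_add_left
      sum.distrib scaleR_sum_right)

lemma affine_formula_std_vertex:
  assumes "j < length as"
  shows "affine_formula as (std_vertex j) = as ! j"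
proof (cases "j = 0")
  case False
  have "(\<Sum>i=1..length as - 1. Poly_Mapping.lookup (std_vertex j) i *\<^sub>R (as ! i - as ! 0))
      = (\<Sum>i=1..length as - 1. if i = j then as ! i - as ! 0 else 0)"
    using False by (intro sum.cong) (auto simp: std_vertex_def lookup_single)
  also have "\<dots> = as ! j - as ! 0"
    using assms False by (subst sum.delta) auto
  finally show ?thesis by (simp add: affine_formula_def)
qed (simp add: affine_formula_def std_vertex_def)

text \<open>Affine maps preserve affine combinations, and this one sends the vertex q_j to
  \<open>as ! j\<close>. Any nonempty list of valid indices is allowed; a face map arises when
  \<open>js\<close> is \<open>[0..<Suc k]\<close> with one entry omitted.\<close>

lemma affine_formula_map_std_vertex:
  assumes "js \<noteq> []" "set js \<subseteq> {..<length as}"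
  shows "affine_formula as (affine_formula (map std_vertex js) x)
    = affine_formula (map ((!) as) js) x"
proof -
  define H where "H = (\<lambda>x. affine_formula as x - as ! 0)"
  interpret H: linear H unfolding H_def by (rule linear_affine_formula)
  have H: "H (std_vertex (js ! i)) = as ! (js ! i) - as ! 0" if "i < length js" for i
    using nth_mem[OF that] assms(2) unfolding H_def by (subst affine_formula_std_vertex) auto
  have len: "0 < length js" using assms by simp
  have "H (affine_formula (map std_vertex js) x) =
      H (std_vertex (js ! 0)) + (\<Sum>i=1..length js - 1. Poly_Mapping.lookup x i *\<^sub>R
        (H (std_vertex (js ! i)) - H (std_vertex (js ! 0))))"
    using len
    by (auto simp: affine_formula_def[of "map _ _"] H.add H.sum H.scaleR H.diff intro!: sum.cong)
  also have "\<dots> = affine_formula (map ((!) as) js) x - as ! 0"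
    using len by (auto simp: affine_formula_def H intro!: sum.cong)
  finally show ?thesis by (simp add: H_def)
qed

text \<open>The preimage of a convex set under an affine map is convex, so it contains the standard
  simplex as soon as it contains its vertices.\<close>

lemma affine_formula_in_convex_hull:
  assumes "as \<noteq> []" "x \<in> std_simplex (length as - 1)"
  shows "affine_formula as x \<in> convex hull (set as)"
proof -
  interpret H: linear "\<lambda>x. affine_formula as x - as ! 0" by (rule linear_affine_formula)
  \<comment> \<open>The constant term \<open>as ! 0\<close> is counted once on the left and
    \<open>u + v\<close> times on the right; these agree because the weights sum to 1.\<close>
  have comb: "affine_formula as (u *\<^sub>R y + v *\<^sub>R z) = u *\<^sub>R affine_formula as y + v *\<^sub>R affine_formula as z"
    if "u + v = 1" for u v y z
  proof -
    have "affine_formula as (u *\<^sub>R y + v *\<^sub>R z)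
        = u *\<^sub>R affine_formula as y + v *\<^sub>R affine_formula as z + as ! 0 - (u + v) *\<^sub>R as ! 0"
      using H.add[of "u *\<^sub>R y" "v *\<^sub>R z"] H.scaleR[of u y] H.scaleR[of v z]
      by (simp add: algebra_simps)
    then show ?thesis using that by simp
  qed
  have "convex {y. affine_formula as y \<in> convex hull (set as)}"
    using convex_convex_hull[of "set as"] by (auto simp: convex_def comb)
  moreover have "std_vertex ` {0..length as - 1} \<subseteq> {y. affine_formula as y \<in> convex hull (set as)}"
  proof clarify
    fix j assume "j \<in> {0..length as - 1}"
    then have "j < length as" using assms(1) by (cases as) auto
    then show "affine_formula as (std_vertex j) \<in> convex hull (set as)"
      by (simp add: affine_formula_std_vertex hull_inc)
  qed
  ultimately show ?thesis
    using assms(2) hull_minimal unfolding std_simplex_def by blast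
qed

lemma lipschitz_affine_formula:
  fixes as :: "'v::real_normed_vector list"
  shows "\<exists>C. C-lipschitz_on (std_simplex k) (affine_formula as)"
proof -
  \<comment> \<open>Each coordinate is 1-Lipschitz for the l1-metric, so the edge from
    \<open>as ! 0\<close> to \<open>as ! i\<close> contributes at most its length to the Lipschitz
    constant.\<close>
  define C where "C = (\<Sum>i=1..length as - 1. norm (as ! i - as ! 0))"
  have coord: "\<bar>Poly_Mapping.lookup x i - Poly_Mapping.lookup y i\<bar> \<le> dist x y"
    for x y :: "nat \<Rightarrow>\<^sub>0 real" and i
  proof (cases "i \<in> Poly_Mapping.keys x \<union> Poly_Mapping.keys y")
    case True
    then show ?thesis
      unfolding dist_poly_mapping_def dist_real_def
      by (intro member_le_sum) auto
  qed (simp add: in_keys_iff)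
  have "dist (affine_formula as x) (affine_formula as y) \<le> C * dist x y" for x y
  proof -
    have "affine_formula as x - affine_formula as y = (\<Sum>i=1..length as - 1.
        (Poly_Mapping.lookup x i - Poly_Mapping.lookup y i) *\<^sub>R (as ! i - as ! 0))"
      by (simp add: affine_formula_def sum_subtractf scaleR_diff_left)
    also have "norm \<dots> \<le> (\<Sum>i=1..length as - 1. norm (as ! i - as ! 0) * dist x y)"
      by (intro sum_norm_le) (simp add: mult.commute[of _ "dist x y"] mult_right_mono coord)
    finally show ?thesis by (simp add: dist_norm C_def sum_distrib_right)
  qed
  then show ?thesis
    by (intro exI lipschitz_onI) (auto simp: C_def sum_nonneg)
qed

lemma affine_simplex_in_lipschitz_simplices:
  fixes as :: "'v::real_normed_vector list"
  assumes "length as = Suc k" "convex hull (set as) \<subseteq> M"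
  shows "affine_simplex as \<in> lipschitz_simplices k M"
proof -
  have "affine_formula as x \<in> M" if "x \<in> std_simplex k" for x
    using affine_formula_in_convex_hull[of as x] that assms by (cases as) auto
  moreover obtain C where "C-lipschitz_on (std_simplex k) (affine_formula as)"
    using lipschitz_affine_formula by blast
  ultimately show ?thesis
    using assms(1) by (auto simp: lipschitz_simplices_def affine_simplex_eq_restrict lipschitz_on_def)
qed

lemma affine_simplex_face:
  assumes "length as = Suc k" "1 \<le> k" "i \<le> k"
  shows "compose (std_simplex (k - 1)) (affine_simplex as)
      (affine_simplex (omit i (map std_vertex [0..<Suc k]))) = affine_simplex (omit i as)"
proof -
  let ?js = "omit i [0..<Suc k]"
  have len: "length ?js = k" using assms by (subst length_omit) auto
  \<comment> \<open>For \<open>k = 0\<close> the only face would be the empty list, which has no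
    base point.\<close>
  then have ne: "?js \<noteq> []" using assms(2) by (metis length_0_conv not_one_le_zero)
  have sub: "set ?js \<subseteq> {..<length as}"
    using set_omit_subset[of i "[0..<Suc k]"] assms by auto
  have as: "map ((!) as) ?js = omit i as"
    using assms by (metis omit_map map_nth)
  \<comment> \<open>The outer map is extensional and agrees with its formula only on
    \<open>std_simplex k\<close>, so the face map must land there.\<close>
  have hull: "affine_formula (map std_vertex ?js) x \<in> std_simplex k" if "x \<in> std_simplex (k - 1)" for x
  proof -
    have "affine_formula (map std_vertex ?js) x \<in> convex hull (set (map std_vertex ?js))"
      using that len ne by (intro affine_formula_in_convex_hull) auto
    also have "\<dots> \<subseteq> std_simplex k"
      unfolding std_simplex_def using sub assms by (intro hull_mono) auto
    finally show ?thesis .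
  qed
  have "length (omit i as) = k" using assms by simp
  then show ?thesis
    unfolding omit_map
    using hull affine_formula_map_std_vertex[OF ne sub] assms(1) len
    by (auto simp: affine_simplex_eq_restrict compose_def as fun_eq_iff restrict_def
        simp del: upt_Suc)
qed

lemma singular_boundary_affine_simplex:
  assumes "length as = Suc k" "1 \<le> k"
  shows "singular_boundary k (basis (affine_simplex as))
    = (\<Sum>i\<le>k. (-1) ^ i *\<^sub>R basis (affine_simplex (omit i as)))"
  using assms affine_simplex_face[OF assms]
  by (auto simp: singular_boundary_def simp del: upt_Suc intro!: sum.cong)

text \<open>Strict sorting excludes repetitions, so the length counts the extreme points of a
  k-simplex, of which there are \<open>Suc k\<close>.\<close>

lemma length_ordered_simplices:
  assumes "vs \<in> ordered_simplices X r k"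
  shows "length vs = Suc k"
proof -
  obtain S where sorted: "sorted_wrt (\<lambda>u v. (u, v) \<in> r \<and> u \<noteq> v) vs"
    and S: "int k simplex S" "set vs = {v. v extreme_point_of S}"
    using assms by (auto simp: ordered_simplices_def)
  have "distinct vs"
    using sorted by (induction vs) auto
  then have "length vs = card {v. v extreme_point_of S}"
    using S by (metis distinct_card)
  also have "\<dots> = Suc k"
    using S(1) by (auto simp: simplex extreme_point_of_convex_hull_affine_independent)
  finally show ?thesis .
qed

lemma convex_hull_cone_subset:
  assumes "star_shaped_wrt (\<Union>X) a" "vs \<in> ordered_simplices X r k"
  shows "convex hull (set (a # vs)) \<subseteq> \<Union>X"
proof -
  obtain S where S: "S \<in> X" "int k simplex S" "set vs = {v. v extreme_point_of S}"
    using assms(2) by (auto simp: ordered_simplices_def)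
  \<comment> \<open>Krein-Milman recovers the simplex from its extreme points.\<close>
  have "convex hull (set vs) = S"
    using S Krein_Milman_Minkowski[of S] compact_simplex convex_simplex by metis
  moreover have "set vs \<noteq> {}"
    using length_ordered_simplices[OF assms(2)] by auto
  ultimately show ?thesis
    using assms(1) S(1)
    by (fastforce simp: convex_hull_insert_segments star_shaped_wrt_def closed_segment_commute[of a])
qed

theorem proposition4p8:
  fixes X :: "(real ^ 'n) set set" and r :: "(real ^ 'n) rel" and a :: "real ^ 'n"
  assumes "geometric_complex X"
    and "linear_order_on (vertices X) r"
    and "star_shaped_wrt (\<Union>X) a"
  shows "singular_cone_operator X r a (\<lambda>k. cone_S a)"
  unfolding singular_cone_operator_def
proof (intro conjI allI ballI impI)
  interpret cone: linear "cone_S a"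
    unfolding cone_S_def by (rule linear_linear_extension)
  \<comment> \<open>Omitting entry \<open>Suc i\<close> of \<open>a # \<sigma>\<close> omits entry
    \<open>i\<close> of \<open>\<sigma>\<close>; this index shift causes the minus sign. The case
    \<open>k = 0\<close> is included.\<close>
  have boundary_cone: "singular_boundary (k + 1) (cone_S a (basis \<sigma>)) = basis (affine_simplex \<sigma>)
      - (\<Sum>i\<le>k. (-1) ^ i *\<^sub>R basis (affine_simplex (a # omit i \<sigma>)))"
    if "\<sigma> \<in> ordered_simplices X r k" for k \<sigma>
    using length_ordered_simplices[OF that]
    by (simp add: cone_S_def singular_boundary_affine_simplex sum.atMost_Suc_shift sum_negf
        del: sum.atMost_Suc)
  {
    fix k
    show "linear_on_subspace (simplicial_chains X r k) (cone_S a)"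
      by (simp add: linear_on_subspace_def cone.add cone.scaleR)
    have "affine_simplex (a # vs) \<in> lipschitz_simplices (Suc k) (\<Union>X)"
      if "vs \<in> ordered_simplices X r k" for vs
      using length_ordered_simplices[OF that] convex_hull_cone_subset[OF assms(3) that]
      by (intro affine_simplex_in_lipschitz_simplices) auto
    then show "cone_S a \<in> simplicial_chains X r k \<rightarrow> lipschitz_chains (Suc k) (\<Union>X)"
      using keys_linear_extension_basis[of "\<lambda>vs. affine_simplex (a # vs)"]
      unfolding cone_S_def simplicial_chains_def lipschitz_chains_def by fast
  next
    fix k \<sigma> assume "1 \<le> k" and \<sigma>: "\<sigma> \<in> ordered_simplices X r k"
    have "cone_S a (simplicial_boundary k (basis \<sigma>))
        = (\<Sum>i\<le>k. (-1) ^ i *\<^sub>R cone_S a (basis (omit i \<sigma>)))"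
      using \<open>1 \<le> k\<close> by (simp add: simplicial_boundary_def cone.sum cone.scaleR)
    then show "cone_S a (simplicial_boundary k (basis \<sigma>))
        + singular_boundary (k + 1) (cone_S a (basis \<sigma>)) = basis (affine_simplex \<sigma>)"
      by (simp only: boundary_cone[OF \<sigma>]) (simp add: cone_S_def)
  next
    \<comment> \<open>In degree 0 the sum in \<open>boundary_cone\<close> has one term: omitting
      \<open>v\<close> from \<open>[v]\<close> leaves the empty list, so the face is L[a].\<close>
    fix v assume "[v] \<in> ordered_simplices X r 0"
    from boundary_cone[OF this]
    show "singular_boundary 1 (cone_S a (basis [v])) = basis (affine_simplex [v]) - basis (affine_simplex [a])"
      by simp
  }
qed

end
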